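(* Let $P\in\mathcal P$ be given, let $\alpha\in[0,1]$, and suppose that the fixed-target noncoverage bound $$\mathrm{pr}_P\{\theta_s(P)\notin C_s(D)\}\leq\alpha\qquad\text{for every fixed } s\in\mathcal S$$ holds. Then $$\mathrm{pr}_P\{\theta_{S^\star}(P)\notin C_{S^\star}(D)\}\leq\alpha+\Lambda_{\rm TV}(P),$$ where $\Lambda_{\rm TV}(P)=E_P\big[d_{\rm TV}\{\mathcal L_P(D\mid S^\star),\mathcal L_P(D)\}\big]$. Consequently, $$\mathrm{pr}_P\{\theta_{S^\star}(P)\notin C_{S^\star}(D)\}\leq\alpha+\{I_P(S^\star;D)/2\}^{1/2},$$ where $I_P(S^\star;D)$ is the mutual information between $S^\star$ and $D$ under $P$.
   Context: Setting. $\mathcal P$ is a class of possible (unknown) distributions. Under $P\in\mathcal P$, $D$ is a random element (the inferential data) of a measurable space $\mathcal D$, and $S^\star$ (the selected object) is a random element of a standard Borel space $\mathcal S$, defined on the same probability space as $D$; the joint law of $(S^\star,D)$ is otherwise arbitrary. $\mathrm{pr}_P$ and $E_P$ denote probability and expectation under $P$, and $\mathcal L_P(\cdot)$ denotes law under $P$. For each $s\in\mathcal S$, $\theta_s(P)\in\mathbb R$ is a fixed (nonrandom) target, and for each $d\in\mathcal D$, $C_s(d)\subseteq\mathbb R$ is a (confidence) set. Measurability assumption: the noncoverage set $\{(s,d):\theta_s(P)\notin C_s(d)\}\subseteq\mathcal S\times\mathcal D$ is measurable for the product $\sigma$-algebra. Leakage: $\mathcal L_P(D\mid S^\star)$ denotes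 a regular conditional law of $D$ given $S^\star$, i.e. a probability kernel $K_P(s,\cdot)=\mathcal L_P(D\mid S^\star=s)$ from $\mathcal S$ to $\mathcal D$ (assumed to exist), evaluated at $s=S^\star$. The total variation distance is $d_{\rm TV}(\nu,\mu)=\sup_A|\nu(A)-\mu(A)|$, the supremum being over measurable $A\subseteq\mathcal D$. In $\Lambda_{\rm TV}(P)$ the expectation is over $S^\star$, and the map $s\mapsto d_{\rm TV}\{K_P(s,\cdot),\mathcal L_P(D)\}$ is taken to be measurable so that this expectation is defined. Mutual information (in nats): $I_P(S^\star;D)={\rm KL}\{\mathcal L_P(S^\star,D)\,\|\,\mathcal L_P(S^\star)\otimes\mathcal L_P(D)\}$, with the convention that it is $+\infty$ if the joint law is not absolutely continuous with respect to the product law. *)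

theory Defs
  imports "HOL-Probability.Probability"
begin

definition standard_borel :: "'a measure \<Rightarrow> bool" where
  "standard_borel M \<longleftrightarrow>
    (\<exists>X. completely_metrizable_space X \<and> second_countable X \<and>
         topspace X = space M \<and> sets M = sigma_sets (space M) {U. openin X U})"

definition tv_dist :: "'a measure \<Rightarrow> 'a measure \<Rightarrow> real" where
  "tv_dist \<nu> \<mu> = (SUP A\<in>sets \<mu>. \<bar>measure \<nu> A - measure \<mu> A\<bar>)"

text \<open>\<open>K\<close> is a regular conditional law of \<open>D\<close> given \<open>S\<close> under \<open>P\<close>: a probability kernel that
  disintegrates the joint law of \<open>(S, D)\<close> over the law of \<open>S\<close>.\<close>

definition regular_conditional_law ::
  "'w measure \<Rightarrow> 's measure \<Rightarrow> 'd measure \<Rightarrow> ('w \<Rightarrow> 's) \<Rightarrow> ('w \<Rightarrow> 'd) \<Rightarrow> ('s \<Rightarrow> 'd measure) \<Rightarrow> bool" where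
  "regular_conditional_law P \<S> \<D> S D K \<longleftrightarrow>
    K \<in> \<S> \<rightarrow>\<^sub>M prob_algebra \<D> \<and>
    (\<forall>A\<in>sets \<S>. \<forall>B\<in>sets \<D>.
      measure P {\<omega> \<in> space P. S \<omega> \<in> A \<and> D \<omega> \<in> B} =
      (LINT s:A | distr P \<S> S. measure (K s) B))"

definition leakage_TV ::
  "'w measure \<Rightarrow> 'd measure \<Rightarrow> ('w \<Rightarrow> 's) \<Rightarrow> ('w \<Rightarrow> 'd) \<Rightarrow> ('s \<Rightarrow> 'd measure) \<Rightarrow> real" where
  "leakage_TV P \<D> S D K = (LINT \<omega> | P. tv_dist (K (S \<omega>)) (distr P \<D> D))"

text \<open>The library's real-valued \<^const>\<open>KL_divergence\<close> takes the reference measure first, and is a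
  Bochner integral, hence \<open>0\<close> when the log-density is not integrable. By
  \<open>integrable_neg_part_entropy_density\<close> below, the negative part of the log-density is always
  integrable, so non-integrability means that the divergence is \<open>\<infinity>\<close>. Base \<open>exp 1\<close> gives nats.\<close>

definition KL :: "'a measure \<Rightarrow> 'a measure \<Rightarrow> ereal" where
  "KL \<nu> \<mu> =
    (if absolutely_continuous \<mu> \<nu> \<and> integrable \<nu> (entropy_density (exp 1) \<mu> \<nu>)
     then ereal (KL_divergence (exp 1) \<mu> \<nu>) else \<infinity>)"

lemma integrable_neg_part_entropy_density:
  assumes "finite_measure \<mu>" "sets \<nu> = sets \<mu>" "absolutely_continuous \<mu> \<nu>"
  shows "integrable \<nu> (\<lambda>x. max 0 (- entropy_density (exp 1) \<mu> \<nu> x))"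
proof -
  interpret finite_measure \<mu> by fact
  let ?f = "RN_deriv \<mu> \<nu>"
  let ?g = "\<lambda>x. max 0 (- entropy_density (exp 1) \<mu> \<nu> x)"
  have dens: "density \<mu> ?f = \<nu>"
    using assms by (intro density_RN_deriv) auto
  have bound: "?f x * ennreal (?g x) \<le> 1" for x
  proof (cases "?f x")
    case (real r)
    have "r * max 0 (- ln r) \<le> 1"
    proof (cases "0 < r \<and> r < 1")
      case True
      then have "- ln r \<le> 1 / r - 1"
        using ln_le_minus_one[of "1 / r"] by (simp add: ln_div)
      then have "r * (- ln r) \<le> r * (1 / r - 1)"
        using True by (intro mult_left_mono) auto
      also have "\<dots> \<le> 1" using True by (simp add: field_simps)
      finally show ?thesis using True by (simp add: max_def)
    next
      case False
      then have "r = 0 \<or> ln r \<ge> 0" using real by auto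
      then show ?thesis by (auto simp: max_def)
    qed
    then have "ennreal (r * max 0 (- ln r)) \<le> 1" by simp
    moreover have "ennreal (r * max 0 (- ln r)) = ennreal r * ennreal (max 0 (- ln r))"
      using real by (intro ennreal_mult) auto
    ultimately show ?thesis
      using real by (simp add: entropy_density_def log_def)
  next
    case top
    then show ?thesis by (simp add: entropy_density_def log_def)
  qed
  have meas: "?g \<in> borel_measurable \<mu>" by measurable
  have "(\<integral>\<^sup>+x. ennreal (?g x) \<partial>\<nu>) = (\<integral>\<^sup>+x. ennreal (?g x) \<partial>density \<mu> ?f)"
    by (simp only: dens)
  also have "\<dots> = (\<integral>\<^sup>+x. ?f x * ennreal (?g x) \<partial>\<mu>)"
    using meas by (intro nn_integral_density) auto
  also have "\<dots> \<le> (\<integral>\<^sup>+x. 1 \<partial>\<mu>)"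
    by (intro nn_integral_mono bound)
  also have "\<dots> < \<infinity>"
    using emeasure_finite by (simp add: less_top[symmetric])
  finally have "(\<integral>\<^sup>+x. ennreal (norm (?g x)) \<partial>\<nu>) < \<infinity>" by simp
  moreover have "?g \<in> borel_measurable \<nu>"
    using meas measurable_cong_sets[OF assms(2) refl] by blast
  ultimately show ?thesis by (intro integrableI_bounded)
qed

definition mutual_info ::
  "'w measure \<Rightarrow> 's measure \<Rightarrow> 'd measure \<Rightarrow> ('w \<Rightarrow> 's) \<Rightarrow> ('w \<Rightarrow> 'd) \<Rightarrow> ereal" where
  "mutual_info P \<S> \<D> S D =
    KL (distr P (\<S> \<Otimes>\<^sub>M \<D>) (\<lambda>\<omega>. (S \<omega>, D \<omega>))) (distr P \<S> S \<Otimes>\<^sub>M distr P \<D> D)"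

definition ereal_sqrt :: "ereal \<Rightarrow> ereal" where
  "ereal_sqrt x = (if x = \<infinity> then \<infinity> else ereal (sqrt (real_of_ereal x)))"

end

theory Submission
  imports Defs
begin

text \<open>
  Write \<open>J\<close> for the joint law of \<open>(S, D)\<close>, \<open>Q\<close> for the product of its marginals, and \<open>E\<close> for the
  noncoverage set. Selective noncoverage is \<open>J E\<close>. The fixed-target hypothesis bounds the mass that
  the law of \<open>D\<close> gives to every section \<open>E\<^sub>s = {d. (s, d) \<in> E}\<close>, so that \<open>Q E \<le> \<alpha>\<close> by Fubini: with a
  selection independent of the data there would be nothing to pay. Both bounds measure what is lost
  on passing from \<open>Q\<close> to \<open>J\<close>.

  For the first bound, disintegration writes \<open>J E\<close> as the average of \<open>K s E\<^sub>s\<close> over the law of \<open>S\<close>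
  (\<open>measure_joint_law_eq_integral\<close>). For each \<open>s\<close>, replacing \<open>K s\<close> by the law of \<open>D\<close> changes the mass
  of the single set \<open>E\<^sub>s\<close> by at most the total variation distance, and averaging gives the leakage.

  For the second bound, one would usually apply Pinsker's inequality to each \<open>K s\<close>, then Jensen's
  inequality and the chain rule for the divergence. It is shorter to compare \<open>J\<close> and \<open>Q\<close> on the one
  event \<open>E\<close>: \<open>J E - Q E \<le> \<surd>(KL J Q / 2)\<close>. This follows from the variational inequality of Donsker
  and Varadhan (\<open>integral_le_KL_divergence\<close>) with a multiple of the centred indicator of \<open>E\<close>, shifted
  by a constant, as test function, its exponential moment being controlled by Hoeffding's lemma
  (\<open>Pinsker_event\<close>).
\<close>

section \<open>Disintegration and total variation\<close>

text \<open>A regular conditional law is only required to be compatible with rectangles. Those form a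
  generator of the product \<open>\<sigma>\<close>-algebra that is closed under intersection, so the joint law is
  the composition of the law of \<open>S\<close> with the kernel, and the formula extends to sets, such as the
  noncoverage set, that are not rectangles.\<close>

lemma measure_joint_law_eq_integral:
  assumes "prob_space P" and S [measurable]: "S \<in> P \<rightarrow>\<^sub>M \<S>" and D [measurable]: "D \<in> P \<rightarrow>\<^sub>M \<D>"
    and K: "regular_conditional_law P \<S> \<D> S D K"
    and E: "E \<in> sets (\<S> \<Otimes>\<^sub>M \<D>)"
  shows "measure (distr P (\<S> \<Otimes>\<^sub>M \<D>) (\<lambda>\<omega>. (S \<omega>, D \<omega>))) E =
    (LINT s | distr P \<S> S. measure (K s) (Pair s -` E))"
proof -
  interpret prob_space P by fact
  interpret L: prob_space "distr P \<S> S" by (rule prob_space_distr) simp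
  have K_prob: "K \<in> \<S> \<rightarrow>\<^sub>M prob_algebra \<D>"
    using K by (simp add: regular_conditional_law_def)
  then have K_meas [measurable]: "K \<in> \<S> \<rightarrow>\<^sub>M subprob_algebra \<D>"
    by (rule measurable_prob_algebraD)
  have K_space: "sets (K s) = sets \<D>" "prob_space (K s)" if "s \<in> space \<S>" for s
    using measurable_space[OF K_prob that] by (auto simp: space_prob_algebra)
  have rect: "measure P {\<omega> \<in> space P. S \<omega> \<in> A \<and> D \<omega> \<in> B} = (LINT s:A | distr P \<S> S. measure (K s) B)"
    if "A \<in> sets \<S>" "B \<in> sets \<D>" for A B
    using K that by (simp add: regular_conditional_law_def)
  define J where "J = distr P (\<S> \<Otimes>\<^sub>M \<D>) (\<lambda>\<omega>. (S \<omega>, D \<omega>))"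
  define R where "R = distr P \<S> S \<bind> (\<lambda>s. distr (K s) (\<S> \<Otimes>\<^sub>M \<D>) (Pair s))"
  interpret J: prob_space J unfolding J_def by (rule prob_space_distr) simp
  have J_sets: "sets J = sets (\<S> \<Otimes>\<^sub>M \<D>)" by (simp add: J_def)
  have kernel: "(\<lambda>s. distr (K s) (\<S> \<Otimes>\<^sub>M \<D>) (Pair s)) \<in> distr P \<S> S \<rightarrow>\<^sub>M subprob_algebra (\<S> \<Otimes>\<^sub>M \<D>)"
    by (simp, rule measurable_distr2[where M = \<D>]) simp_all
  have R_sets: "sets R = sets (\<S> \<Otimes>\<^sub>M \<D>)"
    unfolding R_def using L.not_empty kernel by (intro sets_bind) (auto dest: sets_kernel)
  have R_emeasure: "emeasure R X = (\<integral>\<^sup>+s. emeasure (K s) (Pair s -` X) \<partial>distr P \<S> S)"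
    if X: "X \<in> sets (\<S> \<Otimes>\<^sub>M \<D>)" for X
  proof -
    have "emeasure R X =
        (\<integral>\<^sup>+s. emeasure (distr (K s) (\<S> \<Otimes>\<^sub>M \<D>) (Pair s)) X \<partial>distr P \<S> S)"
      unfolding R_def by (rule emeasure_bind[OF L.not_empty kernel X])
    also have "\<dots> = (\<integral>\<^sup>+s. emeasure (K s) (Pair s -` X) \<partial>distr P \<S> S)"
    proof (rule nn_integral_cong)
      fix s assume "s \<in> space (distr P \<S> S)"
      then have s: "s \<in> space \<S>" by simp
      have "Pair s \<in> K s \<rightarrow>\<^sub>M \<S> \<Otimes>\<^sub>M \<D>"
        using measurable_Pair1'[OF s] measurable_cong_sets[OF K_space(1)[OF s] refl] by blast
      moreover have "Pair s -` X \<inter> space (K s) = Pair s -` X"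
        using sets.sets_into_space[OF sets_Pair1[OF X, of s]] sets_eq_imp_space_eq[OF K_space(1)[OF s]]
        by auto
      ultimately show "emeasure (distr (K s) (\<S> \<Otimes>\<^sub>M \<D>) (Pair s)) X = emeasure (K s) (Pair s -` X)"
        using X by (simp add: emeasure_distr)
    qed
    finally show ?thesis .
  qed
  have section_meas: "(\<lambda>s. measure (K s) (Pair s -` X)) \<in> borel_measurable \<S>"
    if X: "X \<in> sets (\<S> \<Otimes>\<^sub>M \<D>)" for X
  proof (rule measure_measurable_subprob_algebra2[OF _ K_meas])
    have "Sigma (space \<S>) (\<lambda>s. Pair s -` X) = X"
      using sets.sets_into_space[OF X] by (auto simp: space_pair_measure)
    then show "Sigma (space \<S>) (\<lambda>s. Pair s -` X) \<in> sets (\<S> \<Otimes>\<^sub>M \<D>)"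
      using X by simp
  qed
  have R_measure: "emeasure R X = ennreal (LINT s | distr P \<S> S. measure (K s) (Pair s -` X))"
    if X: "X \<in> sets (\<S> \<Otimes>\<^sub>M \<D>)" for X
  proof -
    have "emeasure R X = (\<integral>\<^sup>+s. ennreal (measure (K s) (Pair s -` X)) \<partial>distr P \<S> S)"
      unfolding R_emeasure[OF X]
      by (intro nn_integral_cong)
        (auto simp: finite_measure.emeasure_eq_measure prob_space.finite_measure K_space)
    also have "\<dots> = ennreal (LINT s | distr P \<S> S. measure (K s) (Pair s -` X))"
    proof (intro nn_integral_eq_integral)
      show "integrable (distr P \<S> S) (\<lambda>s. measure (K s) (Pair s -` X))"
        using section_meas[OF X] K_space(2)
        by (intro L.integrable_const_bound[where B = 1]) (auto simp: prob_space.prob_le_1)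
    qed simp
    finally show ?thesis .
  qed
  have "J = R"
  proof (rule measure_eqI_generator_eq[OF Int_stable_pair_measure_generator[of \<S> \<D>] pair_measure_closed,
        where A = "\<lambda>_. space \<S> \<times> space \<D>"])
    fix X assume "X \<in> {a \<times> b | a b. a \<in> sets \<S> \<and> b \<in> sets \<D>}"
    then obtain A B where X: "X = A \<times> B" and A: "A \<in> sets \<S>" and B: "B \<in> sets \<D>" by auto
    have X_sets: "X \<in> sets (\<S> \<Otimes>\<^sub>M \<D>)" using A B X by auto
    have "measure J X = measure P {\<omega> \<in> space P. S \<omega> \<in> A \<and> D \<omega> \<in> B}"
      unfolding J_def using X_sets
      by (subst measure_distr) (auto simp: X intro!: arg_cong[where f = "measure P"])
    also have "\<dots> = (LINT s | distr P \<S> S. measure (K s) (Pair s -` X))"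
      unfolding rect[OF A B] set_lebesgue_integral_def
      by (intro Bochner_Integration.integral_cong) (auto simp: X indicator_def)
    finally show "emeasure J X = emeasure R X"
      by (simp add: R_measure[OF X_sets] J.emeasure_eq_measure)
  next
    show "emeasure J (space \<S> \<times> space \<D>) \<noteq> \<infinity>" by simp
  qed (auto simp: J_sets R_sets sets_pair_measure)
  then have "measure J E = measure R E" by simp
  also have "\<dots> = (LINT s | distr P \<S> S. measure (K s) (Pair s -` E))"
    using R_measure[OF E] by (simp add: measure_def integral_nonneg)
  finally show ?thesis unfolding J_def .
qed

lemma tv_dist_bounds:
  assumes "prob_space \<nu>" "prob_space \<mu>"
  shows measure_le_measure_plus_tv_dist: "A \<in> sets \<mu> \<Longrightarrow> measure \<nu> A \<le> measure \<mu> A + tv_dist \<nu> \<mu>"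
    and tv_dist_nonneg: "0 \<le> tv_dist \<nu> \<mu>"
    and tv_dist_le_1: "tv_dist \<nu> \<mu> \<le> 1"
proof -
  interpret \<nu>: prob_space \<nu> by fact
  interpret \<mu>: prob_space \<mu> by fact
  have le_1: "\<bar>measure \<nu> A - measure \<mu> A\<bar> \<le> 1" for A
    using \<nu>.prob_le_1[of A] \<mu>.prob_le_1[of A] measure_nonneg[of \<nu> A] measure_nonneg[of \<mu> A] by linarith
  have upper: "\<bar>measure \<nu> A - measure \<mu> A\<bar> \<le> tv_dist \<nu> \<mu>" if "A \<in> sets \<mu>" for A
    unfolding tv_dist_def using that le_1 by (intro cSUP_upper bdd_aboveI2[where M = 1]) auto
  show "A \<in> sets \<mu> \<Longrightarrow> measure \<nu> A \<le> measure \<mu> A + tv_dist \<nu> \<mu>" using upper[of A] by linarith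
  show "0 \<le> tv_dist \<nu> \<mu>" using upper[of "{}"] by simp
  show "tv_dist \<nu> \<mu> \<le> 1" unfolding tv_dist_def using le_1 by (intro cSUP_least) auto
qed

section \<open>Pinsker's inequality for a single event\<close>

text \<open>One half of the Donsker--Varadhan variational formula, with the test function normalized so
  that its exponential moment is at most \<open>1\<close>. With \<open>f = d\<nu>/d\<mu>\<close>, the inequality \<open>ln x \<le> x - 1\<close> gives
  \<open>g - ln f = ln (exp g / f) \<le> exp g / f - 1\<close>, and the \<open>\<nu>\<close>-integral of \<open>exp g / f\<close> is at most the
  \<open>\<mu>\<close>-integral of \<open>exp g\<close>.\<close>

lemma integral_le_KL_divergence:
  fixes g :: "'a \<Rightarrow> real"
  assumes "prob_space \<mu>" "prob_space \<nu>" and sets: "sets \<nu> = sets \<mu>"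
    and ac: "absolutely_continuous \<mu> \<nu>"
    and int: "integrable \<nu> (entropy_density (exp 1) \<mu> \<nu>)"
    and g: "integrable \<nu> g" and exp_g: "integrable \<mu> (\<lambda>x. exp (g x))"
    and normalized: "(\<integral>x. exp (g x) \<partial>\<mu>) \<le> 1"
  shows "(\<integral>x. g x \<partial>\<nu>) \<le> KL_divergence (exp 1) \<mu> \<nu>"
proof -
  interpret \<mu>: prob_space \<mu> by fact
  interpret \<nu>: prob_space \<nu> by fact
  obtain f where f [measurable]: "f \<in> borel_measurable \<mu>"
    and RN: "AE x in \<mu>. RN_deriv \<mu> \<nu> x = ennreal (f x)"
    and f_pos: "AE x in \<nu>. 0 < f x" and f_nonneg: "\<And>x. 0 \<le> f x"
    using \<mu>.real_RN_deriv[OF \<nu>.finite_measure ac sets] by auto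
  have "\<nu> = density \<mu> (RN_deriv \<mu> \<nu>)"
    using ac sets by (rule \<mu>.density_RN_deriv[symmetric])
  also have "\<dots> = density \<mu> (\<lambda>x. ennreal (f x))"
    using RN by (intro density_cong) auto
  finally have \<nu>: "\<nu> = density \<mu> (\<lambda>x. ennreal (f x))" .
  have g_meas [measurable]: "g \<in> borel_measurable \<mu>"
    using borel_measurable_integrable[OF g] measurable_cong_sets[OF sets refl] by blast
  have ln_f: "AE x in \<nu>. entropy_density (exp 1) \<mu> \<nu> x = ln (f x)"
    using absolutely_continuous_AE[OF sets ac RN]
    by eventually_elim (simp add: entropy_density_def log_def f_nonneg)
  \<comment> \<open>Where \<open>f\<close> vanishes the quotient is \<open>0\<close>, so the integrand is \<open>exp g\<close> or \<open>0\<close>.\<close>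
  have ratio_int: "integrable \<mu> (\<lambda>x. f x * (exp (g x) / f x))"
    by (rule Bochner_Integration.integrable_bound[OF exp_g]) auto
  have ratio_int': "integrable \<nu> (\<lambda>x. exp (g x) / f x)"
    unfolding \<nu> using ratio_int f_nonneg by (subst integrable_real_density) auto
  have "(\<integral>x. exp (g x) / f x \<partial>\<nu>) = (\<integral>x. f x * (exp (g x) / f x) \<partial>\<mu>)"
    unfolding \<nu> using f_nonneg by (subst integral_real_density) auto
  also have "\<dots> \<le> (\<integral>x. exp (g x) \<partial>\<mu>)"
    by (intro integral_mono ratio_int exp_g) auto
  finally have ratio_le: "(\<integral>x. exp (g x) / f x \<partial>\<nu>) \<le> 1"
    using normalized by linarith
  have "(\<integral>x. g x \<partial>\<nu>) - KL_divergence (exp 1) \<mu> \<nu> =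
      (\<integral>x. g x - entropy_density (exp 1) \<mu> \<nu> x \<partial>\<nu>)"
    unfolding KL_divergence_def using g int by simp
  also have "\<dots> \<le> (\<integral>x. exp (g x) / f x - 1 \<partial>\<nu>)"
  proof (rule integral_mono_AE)
    show "AE x in \<nu>. g x - entropy_density (exp 1) \<mu> \<nu> x \<le> exp (g x) / f x - 1"
      using ln_f f_pos
    proof eventually_elim
      case (elim x)
      then show ?case
        using ln_le_minus_one[of "exp (g x) / f x"] by (simp add: ln_div)
    qed
  qed (use g int ratio_int' in auto)
  also have "\<dots> \<le> 0"
    using ratio_le ratio_int' by (simp add: \<nu>.prob_space)
  finally show ?thesis by simp
qed

text \<open>The test function is \<open>t (indicator E - \<mu> E) - t\<^sup>2 / 8\<close>. Under \<open>\<mu>\<close> the indicator is a Bernoulli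
  variable, and Hoeffding's lemma says that subtracting \<open>t\<^sup>2 / 8\<close> is enough to make the test function
  admissible. Its \<open>\<nu>\<close>-integral \<open>t \<delta> - t\<^sup>2 / 8\<close>, for \<open>\<delta> = \<nu> E - \<mu> E\<close>, has its maximum \<open>2 \<delta>\<^sup>2\<close> at \<open>t = 4 \<delta>\<close>.\<close>

lemma Pinsker_event:
  assumes "prob_space \<mu>" "prob_space \<nu>" and sets: "sets \<nu> = sets \<mu>"
    and ac: "absolutely_continuous \<mu> \<nu>"
    and int: "integrable \<nu> (entropy_density (exp 1) \<mu> \<nu>)"
    and E: "E \<in> sets \<mu>"
  shows "2 * (measure \<nu> E - measure \<mu> E)\<^sup>2 \<le> KL_divergence (exp 1) \<mu> \<nu>"
proof -
  interpret \<mu>: prob_space \<mu> by fact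
  interpret \<nu>: prob_space \<nu> by fact
  have upward: "2 * (measure \<nu> A - measure \<mu> A)\<^sup>2 \<le> KL_divergence (exp 1) \<mu> \<nu>"
    if A [measurable]: "A \<in> sets \<mu>" and le: "measure \<mu> A \<le> measure \<nu> A" for A
  proof -
    define q where "q = measure \<mu> A"
    define t where "t = 4 * (measure \<nu> A - q)"
    define g where "g = (\<lambda>x. t * (indicator A x - q) - t\<^sup>2 / 8)"
    have A' [measurable]: "A \<in> sets \<nu>" using A sets by simp
    have t: "0 \<le> t" and q: "0 \<le> q" using le by (auto simp: t_def q_def)
    have exp_g: "exp (g x) = exp (- t * q - t\<^sup>2 / 8) * (1 + (exp t - 1) * indicator A x)" for x
      by (auto simp: g_def indicator_def algebra_simps simp flip: exp_add)
    have exp_int: "integrable \<mu> (\<lambda>x. exp (g x))"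
      unfolding exp_g by (simp add: \<mu>.emeasure_finite less_top[symmetric])
    have moment_pos: "0 < 1 + q * (exp t - 1)"
      using t q by (intro add_pos_nonneg mult_nonneg_nonneg) auto
    have "(\<integral>x. exp (g x) \<partial>\<mu>) = exp (- t * q - t\<^sup>2 / 8) * (1 + q * (exp t - 1))"
      unfolding exp_g using A sets.sets_into_space[OF A]
      by (simp add: \<mu>.emeasure_finite less_top[symmetric] \<mu>.prob_space q_def Int_absorb2 mult.commute)
    also have "\<dots> = exp (- t * q - t\<^sup>2 / 8 + ln (1 + q * (exp t - 1)))"
      unfolding exp_add[of "- t * q - t\<^sup>2 / 8"] exp_ln[OF moment_pos] by (rule refl)
    also have "\<dots> \<le> 1"
      using Hoeffdings_lemma_aux[OF t q] by simp
    finally have normalized: "(\<integral>x. exp (g x) \<partial>\<mu>) \<le> 1" .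
    have g_int: "integrable \<nu> g"
      unfolding g_def by (simp add: \<nu>.emeasure_finite less_top[symmetric])
    have "(\<integral>x. g x \<partial>\<nu>) = t * (measure \<nu> A - q) - t\<^sup>2 / 8"
      unfolding g_def using sets.sets_into_space[OF A']
      by (simp add: \<nu>.emeasure_finite less_top[symmetric] \<nu>.prob_space Int_absorb2)
    also have "\<dots> = 2 * (measure \<nu> A - q)\<^sup>2"
      by (simp add: t_def power2_eq_square field_simps)
    finally show ?thesis
      using integral_le_KL_divergence[OF assms(1-5) g_int exp_int normalized] by (simp add: q_def)
  qed
  show ?thesis
  proof (cases "measure \<mu> E \<le> measure \<nu> E")
    case True
    then show ?thesis using upward[OF E] by simp
  next
    \<comment> \<open>Passing to the complement changes only the sign of the difference.\<close>
    case False
    have "measure \<nu> (space \<mu> - E) = 1 - measure \<nu> E" "measure \<mu> (space \<mu> - E) = 1 - measure \<mu> E"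
      using E sets \<nu>.prob_compl[of E] \<mu>.prob_compl[of E] sets_eq_imp_space_eq[OF sets] by auto
    then show ?thesis
      using upward[of "space \<mu> - E"] E False by (auto simp: power2_commute)
  qed
qed

section \<open>Selective noncoverage\<close>

theorem theorem1:
  fixes \<P> :: "'w measure set" and P :: "'w measure"
    and \<S> :: "'s measure" and \<D> :: "'d measure"
    and S :: "'w \<Rightarrow> 's" and D :: "'w \<Rightarrow> 'd"
    and \<theta> :: "'s \<Rightarrow> 'w measure \<Rightarrow> real" and C :: "'s \<Rightarrow> 'd \<Rightarrow> real set"
    and K :: "'s \<Rightarrow> 'd measure" and \<alpha> :: real
  assumes model: "\<And>Q. Q \<in> \<P> \<Longrightarrow> prob_space Q \<and> S \<in> Q \<rightarrow>\<^sub>M \<S> \<and> D \<in> Q \<rightarrow>\<^sub>M \<D>"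
    and P: "P \<in> \<P>"
    and standard_borel_S: "standard_borel \<S>"
    and noncoverage_measurable:
      "{(s, d) \<in> space (\<S> \<Otimes>\<^sub>M \<D>). \<theta> s P \<notin> C s d} \<in> sets (\<S> \<Otimes>\<^sub>M \<D>)"
    and K: "regular_conditional_law P \<S> \<D> S D K"
    and tv_measurable: "(\<lambda>s. tv_dist (K s) (distr P \<D> D)) \<in> borel_measurable \<S>"
    and \<alpha>: "\<alpha> \<in> {0..1}"
    and fixed_target: "\<And>s. s \<in> space \<S> \<Longrightarrow> measure P {\<omega> \<in> space P. \<theta> s P \<notin> C s (D \<omega>)} \<le> \<alpha>"
  shows "measure P {\<omega> \<in> space P. \<theta> (S \<omega>) P \<notin> C (S \<omega>) (D \<omega>)} \<le> \<alpha> + leakage_TV P \<D> S D K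
    \<and> ereal (measure P {\<omega> \<in> space P. \<theta> (S \<omega>) P \<notin> C (S \<omega>) (D \<omega>)})
        \<le> ereal \<alpha> + ereal_sqrt (mutual_info P \<S> \<D> S D / 2)"
proof -
  interpret prob_space P using model[OF P] by blast
  have S [measurable]: "S \<in> P \<rightarrow>\<^sub>M \<S>" and D [measurable]: "D \<in> P \<rightarrow>\<^sub>M \<D>"
    using model[OF P] by auto
  define L where "L = distr P \<S> S"
  define M where "M = distr P \<D> D"
  define J where "J = distr P (\<S> \<Otimes>\<^sub>M \<D>) (\<lambda>\<omega>. (S \<omega>, D \<omega>))"
  define E where "E = {(s, d) \<in> space (\<S> \<Otimes>\<^sub>M \<D>). \<theta> s P \<notin> C s d}"
  have E: "E \<in> sets (\<S> \<Otimes>\<^sub>M \<D>)" unfolding E_def by fact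
  interpret L: prob_space L unfolding L_def by (rule prob_space_distr) simp
  interpret M: prob_space M unfolding M_def by (rule prob_space_distr) simp
  interpret J: prob_space J unfolding J_def by (rule prob_space_distr) simp
  interpret Q: pair_prob_space L M ..
  have L_space: "space L = space \<S>" by (simp add: L_def)
  have Q_sets: "sets (L \<Otimes>\<^sub>M M) = sets (\<S> \<Otimes>\<^sub>M \<D>)"
    by (simp add: L_def M_def cong: sets_pair_measure_cong)
  have E_section: "Pair s -` E \<in> sets \<D>" for s
    using sets_Pair1[OF E] .

  have "measure J E = measure P ((\<lambda>\<omega>. (S \<omega>, D \<omega>)) -` E \<inter> space P)"
    unfolding J_def by (rule measure_distr) (use E in simp_all)
  also have "(\<lambda>\<omega>. (S \<omega>, D \<omega>)) -` E \<inter> space P = {\<omega> \<in> space P. \<theta> (S \<omega>) P \<notin> C (S \<omega>) (D \<omega>)}"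
    using measurable_space[OF S] measurable_space[OF D] by (auto simp: E_def space_pair_measure)
  finally have noncoverage: "measure P {\<omega> \<in> space P. \<theta> (S \<omega>) P \<notin> C (S \<omega>) (D \<omega>)} = measure J E" ..

  have section_le: "measure M (Pair s -` E) \<le> \<alpha>" if s: "s \<in> space \<S>" for s
  proof -
    have "measure M (Pair s -` E) = measure P (D -` (Pair s -` E) \<inter> space P)"
      unfolding M_def by (rule measure_distr[OF D E_section])
    also have "D -` (Pair s -` E) \<inter> space P = {\<omega> \<in> space P. \<theta> s P \<notin> C s (D \<omega>)}"
      using s measurable_space[OF D] by (auto simp: E_def space_pair_measure)
    finally show ?thesis using fixed_target[OF s] by simp
  qed

  have K_prob: "prob_space (K s)" if "s \<in> space \<S>" for s
    using K measurable_space[of K \<S> "prob_algebra \<D>"] that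
    by (auto simp: regular_conditional_law_def space_prob_algebra)
  have tv_int: "integrable L (\<lambda>s. tv_dist (K s) M)"
    using tv_measurable tv_dist_nonneg[OF K_prob M.prob_space_axioms]
      tv_dist_le_1[OF K_prob M.prob_space_axioms]
    by (intro L.integrable_const_bound[where B = 1])
      (auto simp: L_def M_def)
  have leakage: "leakage_TV P \<D> S D K = (LINT s | L. tv_dist (K s) M)"
    unfolding leakage_TV_def L_def M_def using tv_measurable by (subst integral_distr) auto
  have "measure J E = (LINT s | L. measure (K s) (Pair s -` E))"
    unfolding J_def L_def
    by (rule measure_joint_law_eq_integral[OF prob_space_axioms S D K E])
  also have "\<dots> \<le> (LINT s | L. \<alpha> + tv_dist (K s) M)"
  proof (rule integral_mono')
    fix s assume "s \<in> space L"
    then have s: "s \<in> space \<S>" by (simp add: L_space)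
    have "measure (K s) (Pair s -` E) \<le> measure M (Pair s -` E) + tv_dist (K s) M"
      using E_section by (intro measure_le_measure_plus_tv_dist K_prob s M.prob_space_axioms) (simp add: M_def)
    then show "measure (K s) (Pair s -` E) \<le> \<alpha> + tv_dist (K s) M"
      using section_le[OF s] by linarith
    then show "0 \<le> \<alpha> + tv_dist (K s) M"
      using measure_nonneg[of "K s" "Pair s -` E"] by linarith
  qed (use tv_int in auto)
  also have "\<dots> = \<alpha> + leakage_TV P \<D> S D K"
    using tv_int by (simp add: leakage L.prob_space)
  finally have tv_bound: "measure J E \<le> \<alpha> + leakage_TV P \<D> S D K" .

  have product_le: "measure (L \<Otimes>\<^sub>M M) E \<le> \<alpha>"
  proof -
    have "emeasure (L \<Otimes>\<^sub>M M) E = (\<integral>\<^sup>+s. emeasure M (Pair s -` E) \<partial>L)"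
      using E Q_sets by (intro M.emeasure_pair_measure_alt) simp
    also have "\<dots> \<le> (\<integral>\<^sup>+s. ennreal \<alpha> \<partial>L)"
      using section_le \<alpha>
      by (intro nn_integral_mono) (auto simp: M.emeasure_eq_measure L_space)
    also have "\<dots> = ennreal \<alpha>" by (simp add: L.emeasure_space_1)
    finally show ?thesis using \<alpha> by (simp add: Q.emeasure_eq_measure)
  qed
  have MI: "mutual_info P \<S> \<D> S D = KL J (L \<Otimes>\<^sub>M M)"
    by (simp add: mutual_info_def J_def L_def M_def)
  have "ereal (measure J E) \<le> ereal \<alpha> + ereal_sqrt (KL J (L \<Otimes>\<^sub>M M) / 2)"
  proof (cases "absolutely_continuous (L \<Otimes>\<^sub>M M) J \<and>
      integrable J (entropy_density (exp 1) (L \<Otimes>\<^sub>M M) J)")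
    case False
    then show ?thesis by (auto simp: KL_def ereal_sqrt_def)
  next
    case True
    define k where "k = KL_divergence (exp 1) (L \<Otimes>\<^sub>M M) J"
    have "2 * (measure J E - measure (L \<Otimes>\<^sub>M M) E)\<^sup>2 \<le> k"
      unfolding k_def using True E Q_sets
      by (intro Pinsker_event Q.prob_space_axioms J.prob_space_axioms) (auto simp: J_def)
    then have "measure J E - measure (L \<Otimes>\<^sub>M M) E \<le> sqrt (k / 2)"
      by (intro real_le_rsqrt) simp
    then have "measure J E \<le> \<alpha> + sqrt (k / 2)"
      using product_le by linarith
    moreover have "KL J (L \<Otimes>\<^sub>M M) / 2 = ereal (k / 2)"
      using True by (simp add: KL_def k_def)
    ultimately show ?thesis by (simp add: ereal_sqrt_def)
  qed
  then show ?thesis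
    using tv_bound unfolding noncoverage MI by simp
qed

end
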